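(* Let $n$ be an even positive integer, $m$ a positive integer, and $a,b$ non-negative integers with $a+b=n$. Let $x_1,\ldots,x_a,y_1,\ldots,y_b$ be complex numbers with $x_1+\cdots+x_a+y_1+\cdots+y_b=0$. Define \[ R_{1,2}(m,n;\tau)= mn\, i^{a}q^{-\frac{n}{4}}\sum_{\substack{r_1,\ldots,r_a,s_1,\ldots,s_b\in\mathbb{Z}\\ 2(r_1+\cdots+r_a+s_1+\cdots+s_b)+n=0}}(-1)^{r_1+\cdots+r_a}q^{r_1^2+\cdots+r_a^2+s_1^2+\cdots+s_b^2}e^{2i(r_1x_1+\cdots+r_ax_a+s_1y_1+\cdots+s_by_b)}. \] Then for all $z\in\mathbb{C}$: if $ma$ is even, \[ \sum_{k=0}^{mn-1}\prod_{j=1}^{a}\vartheta_1\!\left(z+x_j+\tfrac{k\pi}{mn}\Big|\tau\right)\prod_{i=1}^{b}\vartheta_2\!\left(z+y_i+\tfrac{k\pi}{mn}\Big|\tau\right)=R_{1,2}(m,n;\tau)\,\vartheta_3(mnz\,|\,m^2n\tau); \] if $ma$ is odd, the same left-hand side equals $R_{1,2}(m,n;\tau)\,\vartheta_4(mnz\,|\,m^2n\tau)$.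
   Context: Throughout, $\tau\in\mathbb{C}$ with $\Im(\tau)>0$, $q=e^{\pi i\tau}$, and $q^{\alpha}$ means $e^{\pi i\alpha\tau}$ for real $\alpha$. The Jacobi theta functions are $\vartheta_1(z|\tau)=-iq^{1/4}\sum_{n\in\mathbb{Z}}(-1)^nq^{n(n+1)}e^{(2n+1)iz}$, $\vartheta_2(z|\tau)=q^{1/4}\sum_{n\in\mathbb{Z}}q^{n(n+1)}e^{(2n+1)iz}$, $\vartheta_3(z|\tau)=\sum_{n\in\mathbb{Z}}q^{n^2}e^{2niz}$, $\vartheta_4(z|\tau)=\sum_{n\in\mathbb{Z}}(-1)^nq^{n^2}e^{2niz}$; and $\vartheta_j(z|m^2n\tau)$ denotes the same function with $\tau$ replaced by $m^2n\tau$. An empty product equals $1$ (so $a=0$ or $b=0$ is allowed).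
   Formalization: The factor i^a in R_{1,2} is corrected to (-i)^a; with the given ϑ_1 the printed formula has the wrong sign for odd a (e.g. m=1, n=2, a=b=1, y_1=-x_1, z=0), and the two agree for even a. *)

theory Defs
  imports "HOL-Analysis.Analysis"
begin

(* With q = exp (pi i tau), q_pow tau alpha is the branch exp (pi i alpha tau) of q^alpha,
   not a principal power of q. *)
definition q_pow :: "complex \<Rightarrow> real \<Rightarrow> complex" where
  "q_pow \<tau> \<alpha> = exp (of_real pi * \<i> * of_real \<alpha> * \<tau>)"

definition jtheta1 :: "complex \<Rightarrow> complex \<Rightarrow> complex" where
  "jtheta1 z \<tau> = - \<i> * q_pow \<tau> (1/4) *
     (\<Sum>\<^sub>\<infinity>n::int. (-1) powi n * q_pow \<tau> (of_int (n * (n + 1))) * exp (of_int (2 * n + 1) * \<i> * z))"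

definition jtheta2 :: "complex \<Rightarrow> complex \<Rightarrow> complex" where
  "jtheta2 z \<tau> = q_pow \<tau> (1/4) *
     (\<Sum>\<^sub>\<infinity>n::int. q_pow \<tau> (of_int (n * (n + 1))) * exp (of_int (2 * n + 1) * \<i> * z))"

definition jtheta3 :: "complex \<Rightarrow> complex \<Rightarrow> complex" where
  "jtheta3 z \<tau> =
     (\<Sum>\<^sub>\<infinity>n::int. q_pow \<tau> (of_int (n\<^sup>2)) * exp (of_int (2 * n) * \<i> * z))"

definition jtheta4 :: "complex \<Rightarrow> complex \<Rightarrow> complex" where
  "jtheta4 z \<tau> =
     (\<Sum>\<^sub>\<infinity>n::int. (-1) powi n * q_pow \<tau> (of_int (n\<^sup>2)) * exp (of_int (2 * n) * \<i> * z))"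

(* Integer tuples (r_1,...,r_a) and (s_1,...,s_b) are extensional functions on {1..a} and {1..b},
   so that each tuple is counted exactly once. *)
definition R12_index :: "nat \<Rightarrow> nat \<Rightarrow> nat \<Rightarrow> ((nat \<Rightarrow> int) \<times> (nat \<Rightarrow> int)) set" where
  "R12_index n a b =
     {(r, s). r \<in> {1..a} \<rightarrow>\<^sub>E UNIV \<and> s \<in> {1..b} \<rightarrow>\<^sub>E UNIV \<and>
              2 * ((\<Sum>j=1..a. r j) + (\<Sum>j=1..b. s j)) + int n = 0}"

(* The factor (-i)^a comes from the factor -i in each of the a copies of jtheta1.  The source prints
   i^a here, a sign slip that matters exactly when a is odd: for m = 1, n = 2, a = b = 1, z = 0,
   y_1 = -x_1, the sum of products is 2 theta_1(x_1|tau) theta_2(x_1|tau)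
   = 2 theta_1(2 x_1|2 tau) theta_4(0|2 tau), whereas i^a would give the negative of this. *)
definition R12 ::
  "nat \<Rightarrow> nat \<Rightarrow> nat \<Rightarrow> nat \<Rightarrow> (nat \<Rightarrow> complex) \<Rightarrow> (nat \<Rightarrow> complex) \<Rightarrow> complex \<Rightarrow> complex" where
  "R12 m n a b x y \<tau> =
     of_nat (m * n) * (- \<i>) ^ a * q_pow \<tau> (- (real n / 4)) *
     (\<Sum>\<^sub>\<infinity>(r, s)\<in>R12_index n a b.
        (-1) powi (\<Sum>j=1..a. r j) *
        q_pow \<tau> (of_int ((\<Sum>j=1..a. (r j)\<^sup>2) + (\<Sum>j=1..b. (s j)\<^sup>2))) *
        exp (2 * \<i> * ((\<Sum>j=1..a. of_int (r j) * x j) + (\<Sum>j=1..b. of_int (s j) * y j))))"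

end

theory Submission
  imports Defs
begin

text \<open>
  Expanding the product of theta series gives a sum over integer vectors \<open>g\<close> indexed by the \<open>n\<close>
  factors. Since the shifts add up to zero, \<open>g\<close> sees \<open>z + k \<pi> / (m n)\<close> only through its coordinate
  sum \<open>S\<close>, and summing over \<open>k\<close> is a sum over roots of unity that leaves exactly the vectors with
  \<open>S + n / 2 = m n l\<close> for an integer \<open>l\<close>. Subtracting \<open>m l\<close> from every coordinate moves such a vector
  to the hyperplane \<open>2 S + n = 0\<close>; completing the square, the exponent of \<open>q\<close> separates as
  \<open>m\<^sup>2 n l\<^sup>2\<close> plus a term independent of \<open>l\<close>, so the double sum factors, the sum over \<open>l\<close> being a
  theta series with sign \<open>(-1)\<close> to the power \<open>m a l\<close>.
\<close>

text \<open>The sign \<open>\<epsilon>\<close> is \<open>-1\<close> for \<open>\<vartheta>\<^sub>1\<close> and \<open>1\<close> for \<open>\<vartheta>\<^sub>2\<close>.\<close>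

definition theta_term :: "complex \<Rightarrow> complex \<Rightarrow> complex \<Rightarrow> int \<Rightarrow> complex" where
  "theta_term \<epsilon> \<tau> v k =
     \<epsilon> powi k * q_pow \<tau> (of_int (k * (k + 1))) * exp (of_int (2 * k + 1) * \<i> * v)"

lemma jtheta1_eq_theta_term:
  "jtheta1 z \<tau> = - \<i> * q_pow \<tau> (1/4) * infsum (theta_term (-1) \<tau> z) UNIV"
  unfolding jtheta1_def theta_term_def ..

lemma jtheta2_eq_theta_term:
  "jtheta2 z \<tau> = q_pow \<tau> (1/4) * infsum (theta_term 1 \<tau> z) UNIV"
  unfolding jtheta2_def theta_term_def by simp

section \<open>Powers of q\<close>

lemma q_pow_0 [simp]: "q_pow \<tau> 0 = 1"
  by (simp add: q_pow_def)

lemma q_pow_add: "q_pow \<tau> (x + y) = q_pow \<tau> x * q_pow \<tau> y"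
  by (simp add: q_pow_def exp_add[symmetric] algebra_simps)

lemma q_pow_sum: "q_pow \<tau> (sum f I) = (\<Prod>i\<in>I. q_pow \<tau> (f i))"
  by (induction I rule: infinite_finite_induct) (simp_all add: q_pow_add)

lemma q_pow_power: "q_pow \<tau> x ^ n = q_pow \<tau> (of_nat n * x)"
  by (simp add: q_pow_def exp_of_nat_mult[symmetric] algebra_simps)

lemma q_pow_of_nat_mult: "q_pow (of_nat n * \<tau>) x = q_pow \<tau> (of_nat n * x)"
  by (simp add: q_pow_def algebra_simps)

section \<open>Absolute convergence of the theta series\<close>

text \<open>Both halves are geometric series; the negative one is enumerated by
  \<open>- int n - 1\<close> so that 0 is counted only once. This is the majorant for the theta
  series.\<close>

lemma summable_on_exp_minus_abs_int: "(\<lambda>k::int. exp (- \<bar>real_of_int k\<bar>)) summable_on UNIV"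
proof -
  have geo: "(\<lambda>n. exp (- real n)) summable_on UNIV"
  proof (rule norm_summable_imp_summable_on)
    have "summable (\<lambda>n. exp (-1::real) ^ n)"
      by (rule summable_geometric) simp
    then show "summable (\<lambda>n. norm (exp (- real n)))"
      by (simp add: exp_of_nat_mult[symmetric])
  qed
  have pos: "(\<lambda>k::int. exp (- \<bar>real_of_int k\<bar>)) summable_on range int"
    using geo by (subst summable_on_reindex) (auto simp: o_def)
  have "(\<lambda>n. exp (-1) * exp (- real n)) summable_on UNIV"
    using geo by (rule summable_on_cmult_right)
  then have neg: "(\<lambda>k::int. exp (- \<bar>real_of_int k\<bar>)) summable_on range (\<lambda>n. - int n - 1)"
    by (subst summable_on_reindex) (auto simp: o_def inj_on_def exp_add[symmetric] abs_if algebra_simps)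
  have "UNIV = range int \<union> range (\<lambda>n. - int n - 1)"
  proof (intro equalityI subsetI)
    fix k :: int
    show "k \<in> range int \<union> range (\<lambda>n. - int n - 1)"
    proof (cases "k \<ge> 0")
      case True
      then have "k = int (nat k)" by simp
      then show ?thesis by blast
    next
      case False
      then have "k = - int (nat (- k - 1)) - 1" by simp
      then show ?thesis by blast
    qed
  qed simp
  moreover have "range int \<inter> range (\<lambda>n. - int n - 1) = {}"
    by auto
  ultimately show ?thesis
    using summable_on_Un_disjoint[OF pos neg] by simp
qed

text \<open>The norm is the exponential of a quadratic in \<open>k\<close> with negative leading
  coefficient \<open>- pi * Im \<tau>\<close>, which outweighs any linear term. Absolute convergence
  is what allows a product of theta series to be expanded.\<close>

lemma theta_term_abs_summable:
  assumes "Im \<tau> > 0" and "norm \<epsilon> = 1"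
  shows "(\<lambda>k. norm (theta_term \<epsilon> \<tau> v k)) summable_on UNIV"
proof -
  define c where "c = pi * Im \<tau>"
  define d where "d = Im v"
  \<comment> \<open>\<open>B\<close> bounds the coefficient of \<open>\<bar>t\<bar>\<close>:
    \<open>c\<close> comes from \<open>t * (t + 1)\<close>, \<open>2 * \<bar>d\<bar>\<close> from
    \<open>(2 * t + 1) * d\<close>, and 1 is reserved for the decay. In \<open>C\<close>, the part
    \<open>B\<^sup>2 / (4 * c)\<close> is the maximum of
    \<open>B * s - c * s\<^sup>2\<close>.\<close>
  define B where "B = c + 2 * \<bar>d\<bar> + 1"
  define C where "C = \<bar>d\<bar> + B\<^sup>2 / (4 * c)"
  have c: "c > 0" using assms by (simp add: c_def)
  have norm_eq: "norm (theta_term \<epsilon> \<tau> v k)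
      = exp (- c * (of_int k * (of_int k + 1)) - (2 * of_int k + 1) * d)" for k
    using assms(2)
    by (simp add: theta_term_def q_pow_def norm_mult norm_power_int c_def d_def exp_add[symmetric] algebra_simps)
  have bound: "- c * (t * (t + 1)) - (2 * t + 1) * d \<le> C - \<bar>t\<bar>" for t :: real
  proof -
    have "0 \<le> c * (\<bar>t\<bar> - B / (2 * c))\<^sup>2" using c by simp
    also have "\<dots> = c * t\<^sup>2 - B * \<bar>t\<bar> + B\<^sup>2 / (4 * c)"
      using c by (simp add: power2_eq_square field_simps)
    finally have "B * \<bar>t\<bar> - c * t\<^sup>2 \<le> B\<^sup>2 / (4 * c)" by simp
    moreover have "- c * t \<le> c * \<bar>t\<bar>" 
      using c by (metis abs_ge_minus_self less_eq_real_def mult_left_mono mult_minus_left mult_minus_right)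
    moreover have "- (t * d) \<le> \<bar>t\<bar> * \<bar>d\<bar>"
      by (metis abs_ge_minus_self abs_mult)
    moreover have "- d \<le> \<bar>d\<bar>" by simp
    ultimately show ?thesis
      by (simp add: C_def B_def algebra_simps power2_eq_square)
  qed
  have "(\<lambda>k::int. exp C * exp (- \<bar>real_of_int k\<bar>)) summable_on UNIV"
    by (rule summable_on_cmult_right[OF summable_on_exp_minus_abs_int])
  then show ?thesis
    by (rule summable_on_comparison_test)
       (auto simp: norm_eq exp_add[symmetric] intro!: bound[of "of_int _", simplified])
qed

section \<open>Interchange with finite sums, and roots of unity\<close>

lemma infsum_sum_finite:
  fixes f :: "'k \<Rightarrow> 'a \<Rightarrow> 'b::{topological_comm_monoid_add, t2_space}"
  assumes "finite K" and "\<And>k. k \<in> K \<Longrightarrow> f k summable_on A"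
  shows "(\<Sum>\<^sub>\<infinity>x\<in>A. \<Sum>k\<in>K. f k x) = (\<Sum>k\<in>K. infsum (f k) A)"
proof -
  have "((\<lambda>x. \<Sum>k\<in>K. f k x) has_sum (\<Sum>k\<in>K. infsum (f k) A)) A"
    using assms by (induction K) (auto intro!: has_sum_add)
  then show ?thesis by (rule infsumI)
qed

text \<open>The summands are the powers of an \<open>N\<close>-th root of unity, so the geometric
  sum vanishes unless that root is 1. The exponent is written as the translates of \<open>z\<close>
  by \<open>k * pi / N\<close> produce it.\<close>

lemma sum_roots_of_unity:
  fixes N :: nat and t :: int
  assumes "N > 0"
  shows "(\<Sum>k=0..<N. exp (2 * \<i> * of_int t * (of_nat k * of_real pi / of_nat N)))
       = (if int N dvd t then of_nat N else 0 :: complex)"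
proof -
  define \<omega> where "\<omega> = exp (2 * \<i> * of_int t * of_real pi / of_nat N)"
  have pow: "exp (2 * \<i> * of_int t * (of_nat k * of_real pi / of_nat N)) = \<omega> ^ k" for k
    by (simp add: \<omega>_def exp_of_nat_mult[symmetric] algebra_simps)
  have "\<omega> ^ N = exp (2 * of_real pi * \<i> * of_int t)"
    using assms by (simp add: \<omega>_def exp_of_nat_mult[symmetric] algebra_simps)
  then have root: "\<omega> ^ N = 1"
    by (simp add: algebra_simps)
  have one: "\<omega> = 1 \<longleftrightarrow> int N dvd t"
  proof
    assume "\<omega> = 1"
    then obtain l :: int where "2 * real_of_int t * pi / real N = of_int (2 * l) * pi"
      by (auto simp: \<omega>_def exp_eq_1)
    then have "real_of_int t = of_int (l * int N)"
      using assms by (simp add: field_simps)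
    then show "int N dvd t" by (metis dvd_triv_right of_int_eq_iff)
  next
    assume "int N dvd t"
    then obtain l where "t = int N * l" ..
    then have "\<omega> = exp (2 * of_real pi * \<i> * of_int l)"
      using assms by (simp add: \<omega>_def algebra_simps)
    then show "\<omega> = 1"
      by (simp add: algebra_simps)
  qed
  show ?thesis
  proof (cases "\<omega> = 1")
    case True
    then show ?thesis using one unfolding pow by simp
  next
    case False
    then show ?thesis
      using one root geometric_sum[OF False, of N] unfolding pow by (simp add: atLeast0LessThan)
  qed
qed

section \<open>Lattice terms and their translations\<close>

lemma power_int_sum:
  fixes x :: "'a::field"
  assumes "x \<noteq> 0"
  shows "x powi (sum f I) = (\<Prod>i\<in>I. x powi f i)"
  using assms by (induction I rule: infinite_finite_induct) (simp_all add: power_int_add)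

lemma prod_power_int: "(\<Prod>i\<in>I. f i powi k) = (\<Prod>i\<in>I. f i :: 'a::field) powi k"
  by (induction I rule: infinite_finite_induct) (simp_all add: power_int_mult_distrib)

text \<open>A sign and a shift per index treat both kinds of theta factor alike; on
  \<open>{1..a} <+> {1..b}\<close> this becomes the summand of \<open>R12\<close>.\<close>

definition lattice_term ::
  "'i set \<Rightarrow> ('i \<Rightarrow> complex) \<Rightarrow> ('i \<Rightarrow> complex) \<Rightarrow> complex \<Rightarrow> ('i \<Rightarrow> int) \<Rightarrow> complex" where
  "lattice_term I \<epsilon> w \<tau> g =
     (\<Prod>i\<in>I. \<epsilon> i powi g i) * q_pow \<tau> (of_int (\<Sum>i\<in>I. (g i)\<^sup>2)) * exp (2 * \<i> * (\<Sum>i\<in>I. of_int (g i) * w i))"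

text \<open>The exponent \<open>k * (k + 1)\<close> splits into a square and a linear part. The
  \<open>2 * p\<close> summands 1 in the factors \<open>2 * g i + 1\<close> contribute
  \<open>p\<close> to the coefficient of \<open>2 * \<i> * v\<close>, and their contribution to the
  \<open>w i\<close> cancels.\<close>

lemma prod_theta_term:
  assumes "card I = 2 * p" and "sum w I = 0"
  shows "(\<Prod>i\<in>I. theta_term (\<epsilon> i) \<tau> (v + w i) (g i)) =
    lattice_term I \<epsilon> w \<tau> g * q_pow \<tau> (of_int (sum g I)) * exp (2 * \<i> * of_int (sum g I + int p) * v)"
proof -
  have q: "(\<Prod>i\<in>I. q_pow \<tau> (of_int (g i * (g i + 1))))
      = q_pow \<tau> (of_int (\<Sum>i\<in>I. (g i)\<^sup>2)) * q_pow \<tau> (of_int (sum g I))"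
    by (simp add: q_pow_add[symmetric] q_pow_sum[symmetric] sum.distrib[symmetric] power2_eq_square algebra_simps)
  have "(\<Sum>i\<in>I. of_int (2 * g i + 1) * \<i> * (v + w i))
      = (\<Sum>i\<in>I. 2 * \<i> * (of_int (g i) * w i) + \<i> * w i + 2 * \<i> * v * of_int (g i) + \<i> * v)"
    by (intro sum.cong) (simp_all add: algebra_simps)
  also have "\<dots> = 2 * \<i> * (\<Sum>i\<in>I. of_int (g i) * w i) + 2 * \<i> * of_int (sum g I + int p) * v"
    unfolding sum.distrib sum_distrib_left[symmetric] using assms by (simp add: algebra_simps)
  \<comment> \<open>If \<open>I\<close> is infinite, its cardinality is 0 by convention, so
    \<open>p = 0\<close> and both sides are 1.\<close>
  finally have e: "(\<Prod>i\<in>I. exp (of_int (2 * g i + 1) * \<i> * (v + w i)))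
      = exp (2 * \<i> * (\<Sum>i\<in>I. of_int (g i) * w i)) * exp (2 * \<i> * of_int (sum g I + int p) * v)"
    using assms(1) by (cases "finite I") (simp_all add: exp_sum[symmetric] exp_add[symmetric])
  show ?thesis
    unfolding theta_term_def lattice_term_def prod.distrib q e by (simp only: mult_ac)
qed

text \<open>On the hyperplane \<open>sum g I = - int p\<close> the terms linear in \<open>c\<close>
  cancel: \<open>2 * c * sum g I\<close> gives \<open>- 2 * c * p\<close>, and the
  \<open>2 * p\<close> summands \<open>c\<close> give \<open>2 * p * c\<close>. What remains of
  \<open>c\<close> is \<open>2 * p * c\<^sup>2\<close> and a sign.\<close>

lemma lattice_term_shift:
  assumes "card I = 2 * p" and "sum w I = 0" and "sum g I = - int p"
    and "\<And>i. i \<in> I \<Longrightarrow> \<epsilon> i \<noteq> 0"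
  shows "lattice_term I \<epsilon> w \<tau> (\<lambda>i. g i + c) * q_pow \<tau> (of_int (\<Sum>i\<in>I. g i + c)) =
    q_pow \<tau> (- of_nat p) * lattice_term I \<epsilon> w \<tau> g * (prod \<epsilon> I powi c * q_pow \<tau> (of_int (2 * int p * c\<^sup>2)))"
proof -
  have 1: "(\<Prod>i\<in>I. \<epsilon> i powi (g i + c)) = (\<Prod>i\<in>I. \<epsilon> i powi g i) * prod \<epsilon> I powi c"
    using assms(4) by (simp add: power_int_add prod.distrib prod_power_int)
  have 2: "(\<Sum>i\<in>I. of_int (g i + c) * w i) = (\<Sum>i\<in>I. of_int (g i) * w i)"
    using assms(2) by (simp add: ring_distribs sum.distrib sum_distrib_left[symmetric])
  have "(\<Sum>i\<in>I. (g i + c)\<^sup>2) + (\<Sum>i\<in>I. g i + c)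
      = (\<Sum>i\<in>I. (g i)\<^sup>2 + (2 * c + 1) * g i + (c\<^sup>2 + c))"
    unfolding sum.distrib[symmetric]
    by (intro sum.cong) (simp_all add: power2_eq_square algebra_simps)
  also have "\<dots> = - int p + (\<Sum>i\<in>I. (g i)\<^sup>2) + 2 * int p * c\<^sup>2"
    unfolding sum.distrib sum_distrib_left[symmetric] using assms(1,3) by (simp add: algebra_simps)
  finally have "real_of_int (\<Sum>i\<in>I. (g i + c)\<^sup>2) + of_int (\<Sum>i\<in>I. g i + c)
      = - of_nat p + of_int (\<Sum>i\<in>I. (g i)\<^sup>2) + of_int (2 * int p * c\<^sup>2)"
    by (metis (no_types, lifting) of_int_add of_int_minus of_int_of_nat_eq)
  then have 3: "q_pow \<tau> (of_int (\<Sum>i\<in>I. (g i + c)\<^sup>2)) * q_pow \<tau> (of_int (\<Sum>i\<in>I. g i + c))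
      = q_pow \<tau> (- of_nat p) * q_pow \<tau> (of_int (\<Sum>i\<in>I. (g i)\<^sup>2)) * q_pow \<tau> (of_int (2 * int p * c\<^sup>2))"
    by (simp only: q_pow_add[symmetric])
  have "lattice_term I \<epsilon> w \<tau> (\<lambda>i. g i + c) * q_pow \<tau> (of_int (\<Sum>i\<in>I. g i + c)) =
     (\<Prod>i\<in>I. \<epsilon> i powi g i) * prod \<epsilon> I powi c *
     (q_pow \<tau> (of_int (\<Sum>i\<in>I. (g i + c)\<^sup>2)) * q_pow \<tau> (of_int (\<Sum>i\<in>I. g i + c))) *
     exp (2 * \<i> * (\<Sum>i\<in>I. of_int (g i) * w i))"
    unfolding lattice_term_def 1 2 by (simp only: mult_ac)
  then show ?thesis
    unfolding 3 by (simp only: lattice_term_def mult_ac)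
qed

lemma lattice_term_cong:
  "(\<And>i. i \<in> I \<Longrightarrow> g i = h i) \<Longrightarrow> lattice_term I \<epsilon> w \<tau> g = lattice_term I \<epsilon> w \<tau> h"
  by (simp add: lattice_term_def)

section \<open>Averaging a product of theta series\<close>

text \<open>Leaving the signs general covers both parities at once: they enter the last series only
  through \<open>prod \<epsilon> I ^ m\<close>. Unit norm makes each series converge absolutely and
  each sign invertible.\<close>

lemma sum_prod_theta_series:
  fixes \<epsilon> w :: "'i \<Rightarrow> complex"
  assumes "Im \<tau> > 0" and "finite I" and "card I = 2 * p" and "p > 0" and "m > 0"
    and "sum w I = 0" and eps: "\<And>i. i \<in> I \<Longrightarrow> norm (\<epsilon> i) = 1"
  defines "N \<equiv> m * (2 * p)"
  shows "(\<Sum>k=0..<N. \<Prod>i\<in>I. infsum (theta_term (\<epsilon> i) \<tau> (z + of_nat k * of_real pi / of_nat N + w i)) UNIV) =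
     of_nat N * q_pow \<tau> (- of_nat p) *
     (\<Sum>\<^sub>\<infinity>g | g \<in> I \<rightarrow>\<^sub>E UNIV \<and> sum g I = - int p. lattice_term I \<epsilon> w \<tau> g) *
     (\<Sum>\<^sub>\<infinity>l. (prod \<epsilon> I ^ m) powi l * q_pow \<tau> (of_int (int (2 * p * m\<^sup>2) * l\<^sup>2)) * exp (of_int (2 * l) * \<i> * (of_nat N * z)))"
    (is "?L = _ * infsum ?lt ?G0 * infsum ?th UNIV")
proof -
  let ?X = "I \<rightarrow>\<^sub>E (UNIV :: int set)"
  define F where "F v g = (\<Prod>i\<in>I. theta_term (\<epsilon> i) \<tau> (v + w i) (g i))" for v and g :: "'i \<Rightarrow> int"
  define T where "T g = lattice_term I \<epsilon> w \<tau> g * q_pow \<tau> (of_int (sum g I)) * exp (2 * \<i> * of_int (sum g I + int p) * z)" for g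
  define G where "G = {g \<in> ?X. int N dvd sum g I + int p}"
  have N: "N > 0" using assms by simp
  have summ: "F v summable_on ?X" for v
    unfolding F_def
  proof (rule abs_summable_summable, unfold abs_summable_equivalent, rule abs_summable_on_prod_PiE)
    show "Infinite_Set_Sum.abs_summable_on (theta_term (\<epsilon> i) \<tau> (v + w i)) UNIV" if "i \<in> I" for i
      unfolding abs_summable_equivalent[symmetric]
      using theta_term_abs_summable assms(1) eps that by blast
  qed (use assms in auto)
  have prodF: "(\<Prod>i\<in>I. infsum (theta_term (\<epsilon> i) \<tau> (v + w i)) UNIV) = infsum (F v) ?X" for v
    unfolding F_def
    by (rule infsum_prod_PiE_abs[symmetric]) (use assms theta_term_abs_summable in blast)+
  \<comment> \<open>Translating \<open>z\<close> by \<open>u\<close> only multiplies the term by a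
    character of the coordinate sum, so the sum over \<open>k\<close> acts on this factor
    alone.\<close>
  have FT: "F (z + u) g = T g * exp (2 * \<i> * of_int (sum g I + int p) * u)" for u g
    unfolding F_def T_def prod_theta_term[OF assms(3,6)]
    by (simp add: ring_distribs exp_add)
  have "F z = T"
    using FT[of 0] by (auto simp: fun_eq_iff)
  with summ have summT: "T summable_on ?X" by metis
  \<comment> \<open>Translation by \<open>m * l\<close> raises the coordinate sum by
    \<open>2 * p * m * l = N * l\<close>. Restricting to \<open>I\<close> keeps the result
    extensional.\<close>
  define j where "j = (\<lambda>(l, g). \<lambda>i\<in>I. g i + int m * l)"
  have bij: "bij_betw j (UNIV \<times> ?G0) G"
  proof -
    \<comment> \<open>The inverse reads off \<open>l\<close> as a quotient by \<open>N\<close>,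
      which is exact on \<open>G\<close>.\<close>
    define h where "h g = (let l = (sum g I + int p) div int N in (l, \<lambda>i\<in>I. g i - int m * l))" for g
    have sj: "sum (j (l, g)) I = sum g I + int N * l" for l g
      using assms(3) by (simp add: j_def sum.distrib N_def algebra_simps)
    show ?thesis
    proof (rule bij_betw_byWitness[where f' = h])
      show "\<forall>a\<in>UNIV \<times> ?G0. h (j a) = a"
        using N by (auto simp: h_def sj Let_def) (auto simp: j_def fun_eq_iff PiE_def extensional_def)
      show "\<forall>g\<in>G. j (h g) = g"
        by (auto simp: j_def h_def Let_def G_def fun_eq_iff PiE_def extensional_def)
      show "j ` (UNIV \<times> ?G0) \<subseteq> G"
        by (auto simp: G_def sj) (auto simp: j_def)
      show "h ` G \<subseteq> UNIV \<times> ?G0"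
        using assms(3) by (auto simp: h_def Let_def G_def sum_subtractf N_def algebra_simps elim!: dvdE)
    qed
  qed
  \<comment> \<open>Here the coordinate sum plus \<open>p\<close> equals \<open>N * l\<close>, so
    the character in \<open>T\<close> becomes the exponential of a theta series at
    \<open>N * z\<close>.\<close>
  have Tj: "T (j (l, g)) = q_pow \<tau> (- of_nat p) * ?lt g * ?th l" if "g \<in> ?G0" for l g
  proof -
    have "sum (j (l, g)) I = (\<Sum>i\<in>I. g i + int m * l)"
      by (simp add: j_def)
    moreover have "lattice_term I \<epsilon> w \<tau> (j (l, g)) = lattice_term I \<epsilon> w \<tau> (\<lambda>i. g i + int m * l)"
      by (rule lattice_term_cong) (simp add: j_def)
    moreover have "(\<Sum>i\<in>I. g i + int m * l) + int p = int N * l"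
      using that assms(3) by (simp add: sum.distrib N_def algebra_simps)
    moreover have "prod \<epsilon> I powi (int m * l) = (prod \<epsilon> I ^ m) powi l"
      by (simp add: power_int_mult)
    moreover have "2 * int p * (int m * l)\<^sup>2 = int (2 * p * m\<^sup>2) * l\<^sup>2"
      by (simp add: power_mult_distrib)
    moreover have "\<epsilon> i \<noteq> 0" if "i \<in> I" for i
      using eps[OF that] by auto
    ultimately show ?thesis
      unfolding T_def
      using lattice_term_shift[OF assms(3,6), of g \<epsilon> \<tau> "int m * l"] that
      by (simp add: power_mult_distrib mult_ac)
  qed
  \<comment> \<open>Joint summability, needed to iterate the double sum, is inherited from
    \<open>T\<close> on the subset \<open>G\<close> through the bijection.\<close>
  have "(\<lambda>(l, g). q_pow \<tau> (- of_nat p) * ?lt g * ?th l) summable_on UNIV \<times> ?G0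
      \<longleftrightarrow> (\<lambda>c. T (j c)) summable_on UNIV \<times> ?G0"
    by (rule summable_on_cong) (auto simp: Tj simp del: of_int_mult)
  also have "\<dots> \<longleftrightarrow> T summable_on G"
    by (rule summable_on_reindex_bij_betw[OF bij])
  also have "\<dots>"
    using summT by (rule summable_on_subset_banach) (auto simp: G_def)
  finally have summ2: "(\<lambda>(l, g). q_pow \<tau> (- of_nat p) * ?lt g * ?th l) summable_on UNIV \<times> ?G0" .
  have "?L = (\<Sum>k=0..<N. infsum (F (z + of_nat k * of_real pi / of_nat N)) ?X)"
    by (simp add: prodF)
  also have "\<dots> = (\<Sum>\<^sub>\<infinity>g\<in>?X. \<Sum>k=0..<N. F (z + of_nat k * of_real pi / of_nat N) g)"
    by (rule infsum_sum_finite[symmetric]) (auto simp: summ)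
  also have "\<dots> = (\<Sum>\<^sub>\<infinity>g\<in>?X. T g * (if int N dvd sum g I + int p then of_nat N else 0))"
    unfolding FT sum_distrib_left[symmetric] sum_roots_of_unity[OF N] ..
  also have "\<dots> = (\<Sum>\<^sub>\<infinity>g\<in>G. of_nat N * T g)"
    by (rule infsum_cong_neutral) (auto simp: G_def)
  also have "\<dots> = of_nat N * infsum T G"
    by (rule infsum_cmult_right')
  also have "infsum T G = (\<Sum>\<^sub>\<infinity>c\<in>UNIV \<times> ?G0. T (j c))"
    by (rule infsum_reindex_bij_betw[OF bij, symmetric])
  also have "\<dots> = (\<Sum>\<^sub>\<infinity>(l, g)\<in>UNIV \<times> ?G0. q_pow \<tau> (- of_nat p) * ?lt g * ?th l)"
    by (rule infsum_cong) (auto simp: Tj simp del: of_int_mult)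
  also have "\<dots> = (\<Sum>\<^sub>\<infinity>l. \<Sum>\<^sub>\<infinity>g\<in>?G0. q_pow \<tau> (- of_nat p) * ?lt g * ?th l)"
    by (rule infsum_Sigma'_banach[OF summ2, symmetric])
  also have "\<dots> = q_pow \<tau> (- of_nat p) * infsum ?lt ?G0 * infsum ?th UNIV"
    by (simp only: infsum_cmult_left' infsum_cmult_right')
  finally show ?thesis by (simp only: mult_ac)
qed

section \<open>The constant as a lattice sum\<close>

text \<open>A pair of tuples is one function on the disjoint union, and for \<open>n = 2 * p\<close>
  the index condition says that its coordinate sum is \<open>- p\<close>.\<close>

lemma R12_eq_lattice_sum:
  "R12 m (2 * p) a b x y \<tau> = of_nat (m * (2 * p)) * (- \<i>) ^ a * q_pow \<tau> (- (of_nat p / 2)) *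
     (\<Sum>\<^sub>\<infinity>g | g \<in> {1..a} <+> {1..b} \<rightarrow>\<^sub>E UNIV \<and> sum g ({1..a} <+> {1..b}) = - int p.
        lattice_term ({1..a} <+> {1..b}) (case_sum (\<lambda>_. -1) (\<lambda>_. 1)) (case_sum x y) \<tau> g)"
proof -
  let ?I = "{1..a} <+> {1..b}"
  have "(\<Sum>\<^sub>\<infinity>(r, s)\<in>R12_index (2 * p) a b.
        (-1) powi (\<Sum>j=1..a. r j) *
        q_pow \<tau> (of_int ((\<Sum>j=1..a. (r j)\<^sup>2) + (\<Sum>j=1..b. (s j)\<^sup>2))) *
        exp (2 * \<i> * ((\<Sum>j=1..a. of_int (r j) * x j) + (\<Sum>j=1..b. of_int (s j) * y j))))
    = (\<Sum>\<^sub>\<infinity>g | g \<in> ?I \<rightarrow>\<^sub>E UNIV \<and> sum g ?I = - int p.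
        lattice_term ?I (case_sum (\<lambda>_. -1) (\<lambda>_. 1)) (case_sum x y) \<tau> g)"
  proof (rule infsum_reindex_bij_witness[where j = "\<lambda>(r, s). case_sum r s" and i = "\<lambda>g. (g \<circ> Inl, g \<circ> Inr)"])
    fix c assume c: "c \<in> R12_index (2 * p) a b"
    show "((\<lambda>(r, s). case_sum r s) c \<circ> Inl, (\<lambda>(r, s). case_sum r s) c \<circ> Inr) = c"
      by (auto simp: fun_eq_iff split: prod.split)
    show "(\<lambda>(r, s). case_sum r s) c \<in> {g. g \<in> ?I \<rightarrow>\<^sub>E UNIV \<and> sum g ?I = - int p}"
      using c by (auto simp: R12_index_def sum.Plus PiE_def extensional_def split: sum.split) blast+
    show "lattice_term ?I (case_sum (\<lambda>_. -1) (\<lambda>_. 1)) (case_sum x y) \<tau> ((\<lambda>(r, s). case_sum r s) c) =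
      (case c of (r, s) \<Rightarrow> (-1) powi (\<Sum>j=1..a. r j) *
        q_pow \<tau> (of_int ((\<Sum>j=1..a. (r j)\<^sup>2) + (\<Sum>j=1..b. (s j)\<^sup>2))) *
        exp (2 * \<i> * ((\<Sum>j=1..a. of_int (r j) * x j) + (\<Sum>j=1..b. of_int (s j) * y j))))"
      by (auto simp: lattice_term_def sum.Plus prod.Plus power_int_sum split: prod.split)
  next
    fix g :: "nat + nat \<Rightarrow> int" assume g: "g \<in> {g. g \<in> ?I \<rightarrow>\<^sub>E UNIV \<and> sum g ?I = - int p}"
    show "(\<lambda>(r, s). case_sum r s) (g \<circ> Inl, g \<circ> Inr) = g"
      by (auto simp: fun_eq_iff split: sum.split)
    show "(g \<circ> Inl, g \<circ> Inr) \<in> R12_index (2 * p) a b"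
    proof -
      \<comment> \<open>Both components must be extensional for the pair to be a legitimate
        index.\<close>
      have "g (Inl j) = undefined" if "j \<notin> {1..a}" for j
        using g that by (intro PiE_arb[of g ?I "\<lambda>_. UNIV"]) (auto elim!: PlusE)
      moreover have "g (Inr j) = undefined" if "j \<notin> {1..b}" for j
        using g that by (intro PiE_arb[of g ?I "\<lambda>_. UNIV"]) (auto elim!: PlusE)
      moreover have "(\<Sum>j=1..a. g (Inl j)) + (\<Sum>j=1..b. g (Inr j)) = - int p"
        using g by (simp add: sum.Plus)
      ultimately show ?thesis
        by (simp add: R12_index_def PiE_def extensional_def)
    qed
  qed
  then show ?thesis
    by (simp add: R12_def)
qed

section \<open>The identity for mixed products of theta functions\<close>

theorem theorem1p8:
  fixes m n a b :: nat and x y :: "nat \<Rightarrow> complex" and \<tau> z :: complex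
  assumes "Im \<tau> > 0"
    and "even n" and "n > 0" and "m > 0"
    and "a + b = n"
    and "(\<Sum>j=1..a. x j) + (\<Sum>i=1..b. y i) = 0"
  shows "(even (m * a) \<longrightarrow>
            (\<Sum>k=0..<m * n.
               (\<Prod>j=1..a. jtheta1 (z + x j + of_nat k * of_real pi / of_nat (m * n)) \<tau>) *
               (\<Prod>i=1..b. jtheta2 (z + y i + of_nat k * of_real pi / of_nat (m * n)) \<tau>))
            = R12 m n a b x y \<tau> * jtheta3 (of_nat (m * n) * z) (of_nat (m\<^sup>2 * n) * \<tau>)) \<and>
         (odd (m * a) \<longrightarrow>
            (\<Sum>k=0..<m * n.
               (\<Prod>j=1..a. jtheta1 (z + x j + of_nat k * of_real pi / of_nat (m * n)) \<tau>) *
               (\<Prod>i=1..b. jtheta2 (z + y i + of_nat k * of_real pi / of_nat (m * n)) \<tau>))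
            = R12 m n a b x y \<tau> * jtheta4 (of_nat (m * n) * z) (of_nat (m\<^sup>2 * n) * \<tau>))"
proof -
  obtain p where n: "n = 2 * p" using assms(2) by (elim evenE)
  define I where "I = {1..a} <+> {1..b}"
  define \<epsilon> :: "nat + nat \<Rightarrow> complex" where "\<epsilon> = case_sum (\<lambda>_. -1) (\<lambda>_. 1)"
  define w where "w = case_sum x y"
  define \<Theta> where "\<Theta> = (\<Sum>\<^sub>\<infinity>l. (((-1) ^ a) ^ m) powi l * q_pow \<tau> (of_int (int (2 * p * m\<^sup>2) * l\<^sup>2)) *
    exp (of_int (2 * l) * \<i> * (of_nat (m * n) * z)))"
  let ?u = "\<lambda>k. of_nat k * of_real pi / of_nat (m * n) :: complex"
  have card: "card I = 2 * p"
    using assms(5) n by (simp add: I_def card_Plus)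
  have prod_eps: "prod \<epsilon> I = (-1) ^ a"
    by (simp add: I_def \<epsilon>_def prod.Plus)
  \<comment> \<open>Each of the \<open>2 * p\<close> factors carries \<open>q\<close> to the power
    1/4, and only the first kind carries \<open>- \<i>\<close>.\<close>
  have quarter: "(- \<i> * q_pow \<tau> (1/4)) ^ a * q_pow \<tau> (1/4) ^ b = (- \<i>) ^ a * q_pow \<tau> (of_nat p / 2)"
  proof -
    have "real a * (1/4) + real b * (1/4) = real p / 2"
      using assms(5) n by (simp flip: of_nat_add distrib_right)
    then show ?thesis
      by (simp only: power_mult_distrib q_pow_power mult.assoc q_pow_add[symmetric])
  qed
  have "(\<Prod>j=1..a. jtheta1 (z + x j + u) \<tau>) * (\<Prod>i=1..b. jtheta2 (z + y i + u) \<tau>) =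
     (- \<i>) ^ a * q_pow \<tau> (of_nat p / 2) * (\<Prod>i\<in>I. infsum (theta_term (\<epsilon> i) \<tau> (z + u + w i)) UNIV)" for u
    unfolding quarter[symmetric] jtheta1_eq_theta_term jtheta2_eq_theta_term
    by (simp only: I_def \<epsilon>_def w_def prod.Plus finite_atLeastAtMost o_def sum.case prod.distrib
      prod_constant card_atLeastAtMost diff_Suc_1 power_mult_distrib add_ac mult_ac)
  then have "(\<Sum>k=0..<m * n. (\<Prod>j=1..a. jtheta1 (z + x j + ?u k) \<tau>) * (\<Prod>i=1..b. jtheta2 (z + y i + ?u k) \<tau>))
    = (- \<i>) ^ a * q_pow \<tau> (of_nat p / 2) *
      (\<Sum>k=0..<m * n. \<Prod>i\<in>I. infsum (theta_term (\<epsilon> i) \<tau> (z + ?u k + w i)) UNIV)"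
    by (simp only: sum_distrib_left)
  also have "(\<Sum>k=0..<m * n. \<Prod>i\<in>I. infsum (theta_term (\<epsilon> i) \<tau> (z + ?u k + w i)) UNIV) =
     of_nat (m * n) * q_pow \<tau> (- of_nat p) *
     (\<Sum>\<^sub>\<infinity>g | g \<in> I \<rightarrow>\<^sub>E UNIV \<and> sum g I = - int p. lattice_term I \<epsilon> w \<tau> g) * \<Theta>"
    unfolding \<Theta>_def prod_eps[symmetric] n
  proof (rule sum_prod_theta_series)
    show "finite I" by (simp add: I_def)
    show "sum w I = 0" using assms(6) by (simp add: I_def w_def sum.Plus)
    show "norm (\<epsilon> i) = 1" for i by (simp add: \<epsilon>_def split: sum.split)
  qed (use assms n card in auto)
  \<comment> \<open>The power \<open>p / 2\<close> from the theta prefactors meets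
    \<open>- p\<close> from the translation, leaving \<open>- p / 2 = - n / 4\<close> as in
    \<open>R12\<close>.\<close>
  also have "(- \<i>) ^ a * q_pow \<tau> (of_nat p / 2) * (of_nat (m * n) * q_pow \<tau> (- of_nat p) * S * \<Theta>)
     = of_nat (m * n) * (- \<i>) ^ a * q_pow \<tau> (- (of_nat p / 2)) * S * \<Theta>" for S
  proof -
    have "q_pow \<tau> (- (of_nat p / 2)) = q_pow \<tau> (of_nat p / 2) * q_pow \<tau> (- of_nat p)"
      by (simp flip: q_pow_add)
    then show ?thesis by (simp only: mult_ac)
  qed
  also have "of_nat (m * n) * (- \<i>) ^ a * q_pow \<tau> (- (of_nat p / 2)) *
     (\<Sum>\<^sub>\<infinity>g | g \<in> I \<rightarrow>\<^sub>E UNIV \<and> sum g I = - int p. lattice_term I \<epsilon> w \<tau> g) = R12 m n a b x y \<tau>"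
    unfolding n R12_eq_lattice_sum I_def \<epsilon>_def w_def ..
  finally have main: "(\<Sum>k=0..<m * n. (\<Prod>j=1..a. jtheta1 (z + x j + ?u k) \<tau>) * (\<Prod>i=1..b. jtheta2 (z + y i + ?u k) \<tau>))
    = R12 m n a b x y \<tau> * \<Theta>" .
  \<comment> \<open>This sign is the base of \<open>powi l\<close> in \<open>\<Theta>\<close>, so
    its value separates \<open>jtheta3\<close> from \<open>jtheta4\<close>.\<close>
  have sign: "((-1) ^ a) ^ m = (if even (m * a) then 1 else -1 :: complex)"
    by (auto simp flip: power_mult simp: uminus_power_if)
  have q: "q_pow (of_nat (m\<^sup>2 * n) * \<tau>) (of_int (l\<^sup>2)) = q_pow \<tau> (of_int (int (2 * p * m\<^sup>2) * l\<^sup>2))" for l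
    unfolding q_pow_of_nat_mult n by (simp add: mult_ac)
  have "\<Theta> = jtheta3 (of_nat (m * n) * z) (of_nat (m\<^sup>2 * n) * \<tau>)" if "even (m * a)"
    using that unfolding \<Theta>_def jtheta3_def q sign by simp
  moreover have "\<Theta> = jtheta4 (of_nat (m * n) * z) (of_nat (m\<^sup>2 * n) * \<tau>)" if "odd (m * a)"
    using that unfolding \<Theta>_def jtheta4_def q sign by simp
  ultimately show ?thesis
    unfolding main by simp
qed

end
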